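(* Let $(\bm u_h,\bm E_h,\bm B_h)\in\bm X_h$ and $p_h\in Q_h$ be any solution of the problem: for all $(\bm v,\bm F,\bm C)\in\bm X_h$ and $q\in Q_h$, $$L(\bm u_h;\bm u_h,\bm v)+R_e^{-1}(\nabla\bm u_h,\nabla\bm v)-S(\bm j_h\times\bm B_h,\bm v)-(p_h,\nabla\cdot\bm v)=\langle\bm f,\bm v\rangle,$$ $$S(\bm j_h,\bm F)-\alpha(\bm B_h,\nabla\times\bm F)=0,$$ $$\alpha(\nabla\times\bm E_h,\bm C)+\alpha(\nabla\cdot\bm B_h,\nabla\cdot\bm C)=0,$$ $$-(\nabla\cdot\bm u_h,q)=0,$$ where $\bm j_h=\bm E_h+\bm u_h\times\bm B_h$. Then: (1) $\nabla\cdot\bm B_h=0$ (magnetic Gauss's law in the strong sense); (2) $R_e^{-1}\|\nabla\bm u_h\|^2+S\|\bm j_h\|^2=\langle\bm f,\bm u_h\rangle$ and $\frac12R_e^{-1}\|\nabla\bm u_h\|^2+S\|\bm j_h\|^2\le\frac{R_e}{2}\|\bm f\|_{-1}^2$.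
   Context: $\Omega\subset\mathbb R^3$ is a bounded contractible Lipschitz polyhedron. $(\cdot,\cdot)$, $\|\cdot\|$: $L^2(\Omega)$ inner product and norm. $R_e,R_m,S>0$ are constants, $\alpha:=SR_m^{-1}$, $\bm f\in[H^{-1}(\Omega)]^3$, $\|\bm f\|_{-1}:=\sup_{0\ne\bm v\in[H_0^1(\Omega)]^3}\langle\bm f,\bm v\rangle/\|\nabla\bm v\|$. $L(\bm w;\bm u,\bm v):=\frac12[((\bm w\cdot\nabla)\bm u,\bm v)-((\bm w\cdot\nabla)\bm v,\bm u)]$. $\mathcal T_h$ is a shape-regular, quasi-uniform simplicial triangulation of $\Omega$. $H_0^h(\mathrm{grad},\Omega)\xrightarrow{\nabla}H_0^h(\mathrm{curl},\Omega)\xrightarrow{\nabla\times}H_0^h(\mathrm{div},\Omega)\xrightarrow{\nabla\cdot}L_0^{2,h}(\Omega)$ is a standard conforming finite element de Rham complex on $\mathcal T_h$ (Lagrange, Nédélec, Raviart–Thomas or BDM, discontinuous elements) with homogeneous boundary conditions; it is exact. $\bm V_h\subset[H_0^1(\Omega)]^3$, $Q_h\subset L_0^2(\Omega)$ are an inf-sup stable Stokes finite element pair. $\bm X_h:=\bm V_h\times H_0^h(\mathrm{curl},\Omega)\times H_0^h(\mathrm{div},\Omega)$. *)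

theory Defs
  imports "HOL-Analysis.Analysis"
begin

text \<open>
  Functions on \<open>\<Omega>\<close> are represented by total functions on \<open>real^3\<close> whose values outside \<open>\<Omega>\<close> are
  irrelevant; all identities between Lebesgue or Sobolev functions are meant almost everywhere
  in \<open>\<Omega>\<close>.
\<close>

section \<open>The domain and its triangulations\<close>

definition lipschitz_domain :: "(real^3) set \<Rightarrow> bool" where
  "lipschitz_domain \<Omega> \<longleftrightarrow>
     (\<forall>x\<in>frontier \<Omega>. \<exists>r>0. \<exists>A::real^3 \<Rightarrow> real^3. \<exists>\<gamma>::real^2 \<Rightarrow> real. \<exists>M.
        orthogonal_transformation A \<and> M-lipschitz_on UNIV \<gamma> \<and>
        (\<forall>y\<in>ball x r. y \<in> \<Omega> \<longleftrightarrow> \<gamma> (vector [A y $ 1, A y $ 2]) < A y $ 3))"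

text \<open>The library predicate \<^const>\<open>polyhedron\<close> is restricted to convex sets, hence the union.\<close>

definition contractible_lipschitz_polyhedron :: "(real^3) set \<Rightarrow> bool" where
  "contractible_lipschitz_polyhedron \<Omega> \<longleftrightarrow>
     \<Omega> \<noteq> {} \<and> open \<Omega> \<and> bounded \<Omega> \<and> contractible \<Omega> \<and> lipschitz_domain \<Omega> \<and>
     (\<exists>\<P>. finite \<P> \<and> (\<forall>P\<in>\<P>. polytope P) \<and> closure \<Omega> = \<Union>\<P>)"

definition simplicial_mesh :: "(real^3) set \<Rightarrow> (real^3) set set \<Rightarrow> bool" where
  "simplicial_mesh \<Omega> \<T> \<longleftrightarrow> triangulation \<T> \<and> (\<forall>K\<in>\<T>. 3 simplex K) \<and> \<Union>\<T> = closure \<Omega>"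

definition inradius :: "(real^3) set \<Rightarrow> real" where
  "inradius K = Sup {r. 0 \<le> r \<and> (\<exists>x. cball x r \<subseteq> K)}"

text \<open>
  Shape regularity and quasi-uniformity are uniform bounds over a family of meshes; for a
  single member of the family they are stated with the constant of the family as a parameter.
\<close>

definition shape_regular :: "real \<Rightarrow> (real^3) set set \<Rightarrow> bool" where
  "shape_regular \<sigma> \<T> \<longleftrightarrow> (\<forall>K\<in>\<T>. diameter K \<le> \<sigma> * inradius K)"

definition quasi_uniform :: "real \<Rightarrow> (real^3) set set \<Rightarrow> bool" where
  "quasi_uniform \<tau> \<T> \<longleftrightarrow> (\<forall>K\<in>\<T>. \<forall>K'\<in>\<T>. diameter K' \<le> \<tau> * diameter K)"


section \<open>Square integrable functions\<close>

definition L2 :: "(real^3) set \<Rightarrow> (real^3 \<Rightarrow> 'b::euclidean_space) set" where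
  "L2 \<Omega> = {f. f \<in> borel_measurable (lebesgue_on \<Omega>) \<and>
              integrable (lebesgue_on \<Omega>) (\<lambda>x. (norm (f x))\<^sup>2)}"

definition l2_inner ::
    "(real^3) set \<Rightarrow> (real^3 \<Rightarrow> 'b::euclidean_space) \<Rightarrow> (real^3 \<Rightarrow> 'b) \<Rightarrow> real" where
  "l2_inner \<Omega> f g = (LINT x|lebesgue_on \<Omega>. f x \<bullet> g x)"

definition l2_norm :: "(real^3) set \<Rightarrow> (real^3 \<Rightarrow> 'b::euclidean_space) \<Rightarrow> real" where
  "l2_norm \<Omega> f = sqrt (l2_inner \<Omega> f f)"

definition ae_eq ::
    "(real^3) set \<Rightarrow> (real^3 \<Rightarrow> 'b::euclidean_space) \<Rightarrow> (real^3 \<Rightarrow> 'b) \<Rightarrow> bool" where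
  "ae_eq \<Omega> f g \<longleftrightarrow> (AE x in lebesgue_on \<Omega>. f x = g x)"

definition L2_zero_mean :: "(real^3) set \<Rightarrow> (real^3 \<Rightarrow> real) set" where
  "L2_zero_mean \<Omega> = {q \<in> L2 \<Omega>. (LINT x|lebesgue_on \<Omega>. q x) = 0}"


section \<open>Test functions\<close>

definition pd :: "3 \<Rightarrow> (real^3 \<Rightarrow> real) \<Rightarrow> real^3 \<Rightarrow> real" where
  "pd i \<phi> x = frechet_derivative \<phi> (at x) (axis i 1)"

primrec Ck :: "nat \<Rightarrow> (real^3 \<Rightarrow> real) \<Rightarrow> bool" where
  "Ck 0 \<phi> \<longleftrightarrow> continuous_on UNIV \<phi>"
| "Ck (Suc n) \<phi> \<longleftrightarrow> (\<forall>x. \<phi> differentiable (at x)) \<and> (\<forall>i. Ck n (pd i \<phi>))"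

definition test_functions :: "(real^3) set \<Rightarrow> (real^3 \<Rightarrow> real) set" where
  "test_functions \<Omega> = {\<phi>. (\<forall>n. Ck n \<phi>) \<and> (\<exists>K. compact K \<and> K \<subseteq> \<Omega> \<and> (\<forall>x. x \<notin> K \<longrightarrow> \<phi> x = 0))}"

definition test_fields :: "(real^3) set \<Rightarrow> (real^3 \<Rightarrow> real^3) set" where
  "test_fields \<Omega> = {\<phi>. \<forall>i. (\<lambda>x. \<phi> x $ i) \<in> test_functions \<Omega>}"

definition cgrad :: "(real^3 \<Rightarrow> real) \<Rightarrow> real^3 \<Rightarrow> real^3" where
  "cgrad \<phi> x = (\<chi> i. pd i \<phi> x)"

definition cdiv :: "(real^3 \<Rightarrow> real^3) \<Rightarrow> real^3 \<Rightarrow> real" where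
  "cdiv \<phi> x = (\<Sum>i\<in>UNIV. pd i (\<lambda>y. \<phi> y $ i) x)"

definition ccurl :: "(real^3 \<Rightarrow> real^3) \<Rightarrow> real^3 \<Rightarrow> real^3" where
  "ccurl \<phi> x = vector
     [pd 2 (\<lambda>y. \<phi> y $ 3) x - pd 3 (\<lambda>y. \<phi> y $ 2) x,
      pd 3 (\<lambda>y. \<phi> y $ 1) x - pd 1 (\<lambda>y. \<phi> y $ 3) x,
      pd 1 (\<lambda>y. \<phi> y $ 2) x - pd 2 (\<lambda>y. \<phi> y $ 1) x]"


section \<open>Weak derivatives\<close>

definition is_weak_grad ::
    "(real^3) set \<Rightarrow> (real^3 \<Rightarrow> real) \<Rightarrow> (real^3 \<Rightarrow> real^3) \<Rightarrow> bool" where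
  "is_weak_grad \<Omega> f g \<longleftrightarrow>
     (\<forall>\<phi>\<in>test_fields \<Omega>. l2_inner \<Omega> g \<phi> = - l2_inner \<Omega> f (cdiv \<phi>))"

definition is_weak_curl ::
    "(real^3) set \<Rightarrow> (real^3 \<Rightarrow> real^3) \<Rightarrow> (real^3 \<Rightarrow> real^3) \<Rightarrow> bool" where
  "is_weak_curl \<Omega> f g \<longleftrightarrow>
     (\<forall>\<phi>\<in>test_fields \<Omega>. l2_inner \<Omega> g \<phi> = l2_inner \<Omega> f (ccurl \<phi>))"

definition is_weak_div ::
    "(real^3) set \<Rightarrow> (real^3 \<Rightarrow> real^3) \<Rightarrow> (real^3 \<Rightarrow> real) \<Rightarrow> bool" where
  "is_weak_div \<Omega> f g \<longleftrightarrow>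
     (\<forall>\<phi>\<in>test_functions \<Omega>. l2_inner \<Omega> g \<phi> = - l2_inner \<Omega> f (cgrad \<phi>))"

definition H1 :: "(real^3) set \<Rightarrow> (real^3 \<Rightarrow> real) set" where
  "H1 \<Omega> = {f \<in> L2 \<Omega>. \<exists>g\<in>L2 \<Omega>. is_weak_grad \<Omega> f g}"

definition Hcurl :: "(real^3) set \<Rightarrow> (real^3 \<Rightarrow> real^3) set" where
  "Hcurl \<Omega> = {f \<in> L2 \<Omega>. \<exists>g\<in>L2 \<Omega>. is_weak_curl \<Omega> f g}"

definition Hdiv :: "(real^3) set \<Rightarrow> (real^3 \<Rightarrow> real^3) set" where
  "Hdiv \<Omega> = {f \<in> L2 \<Omega>. \<exists>g\<in>L2 \<Omega>. is_weak_div \<Omega> f g}"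

text \<open>
  The weak derivatives are determined up to null sets, so the choice operator merely picks a
  representative. It is meaningful only on \<^const>\<open>H1\<close>, \<^const>\<open>Hcurl\<close> and \<^const>\<open>Hdiv\<close>.
\<close>

definition wgrad :: "(real^3) set \<Rightarrow> (real^3 \<Rightarrow> real) \<Rightarrow> real^3 \<Rightarrow> real^3" where
  "wgrad \<Omega> f = (SOME g. g \<in> L2 \<Omega> \<and> is_weak_grad \<Omega> f g)"

definition wcurl :: "(real^3) set \<Rightarrow> (real^3 \<Rightarrow> real^3) \<Rightarrow> real^3 \<Rightarrow> real^3" where
  "wcurl \<Omega> f = (SOME g. g \<in> L2 \<Omega> \<and> is_weak_curl \<Omega> f g)"

definition wdiv :: "(real^3) set \<Rightarrow> (real^3 \<Rightarrow> real^3) \<Rightarrow> real^3 \<Rightarrow> real" where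
  "wdiv \<Omega> f = (SOME g. g \<in> L2 \<Omega> \<and> is_weak_div \<Omega> f g)"

text \<open>
  Gradient of a vector field; row \<open>i\<close> is the gradient of component \<open>i\<close>. The inner product of
  \<^typ>\<open>real^3^3\<close> is the Frobenius product, and \<open>(w \<cdot> \<nabla>) u\<close> is \<open>wjac \<Omega> u x *v w x\<close>.
\<close>

definition wjac :: "(real^3) set \<Rightarrow> (real^3 \<Rightarrow> real^3) \<Rightarrow> real^3 \<Rightarrow> real^3^3" where
  "wjac \<Omega> u x = (\<chi> i. wgrad \<Omega> (\<lambda>y. u y $ i) x)"

text \<open>
  Homogeneous boundary conditions: closures of the compactly supported smooth functions in
  the respective graph norms.
\<close>

definition H1_0 :: "(real^3) set \<Rightarrow> (real^3 \<Rightarrow> real) set" where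
  "H1_0 \<Omega> = {f \<in> H1 \<Omega>. \<forall>\<epsilon>>0. \<exists>\<phi>\<in>test_functions \<Omega>.
      (l2_norm \<Omega> (\<lambda>x. f x - \<phi> x))\<^sup>2 + (l2_norm \<Omega> (\<lambda>x. wgrad \<Omega> f x - cgrad \<phi> x))\<^sup>2 < \<epsilon>\<^sup>2}"

definition Hcurl_0 :: "(real^3) set \<Rightarrow> (real^3 \<Rightarrow> real^3) set" where
  "Hcurl_0 \<Omega> = {f \<in> Hcurl \<Omega>. \<forall>\<epsilon>>0. \<exists>\<phi>\<in>test_fields \<Omega>.
      (l2_norm \<Omega> (\<lambda>x. f x - \<phi> x))\<^sup>2 + (l2_norm \<Omega> (\<lambda>x. wcurl \<Omega> f x - ccurl \<phi> x))\<^sup>2 < \<epsilon>\<^sup>2}"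

definition Hdiv_0 :: "(real^3) set \<Rightarrow> (real^3 \<Rightarrow> real^3) set" where
  "Hdiv_0 \<Omega> = {f \<in> Hdiv \<Omega>. \<forall>\<epsilon>>0. \<exists>\<phi>\<in>test_fields \<Omega>.
      (l2_norm \<Omega> (\<lambda>x. f x - \<phi> x))\<^sup>2 + (l2_norm \<Omega> (\<lambda>x. wdiv \<Omega> f x - cdiv \<phi> x))\<^sup>2 < \<epsilon>\<^sup>2}"

definition H1_0_vec :: "(real^3) set \<Rightarrow> (real^3 \<Rightarrow> real^3) set" where
  "H1_0_vec \<Omega> = {v. \<forall>i. (\<lambda>x. v x $ i) \<in> H1_0 \<Omega>}"

text \<open>
  The dual space of \<^const>\<open>H1_0_vec\<close>. As elements of the latter are classes of functions,
  a functional has to respect equality almost everywhere.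
\<close>

definition Hm1_vec :: "(real^3) set \<Rightarrow> ((real^3 \<Rightarrow> real^3) \<Rightarrow> real) set" where
  "Hm1_vec \<Omega> = {f.
     (\<forall>v\<in>H1_0_vec \<Omega>. \<forall>w\<in>H1_0_vec \<Omega>. ae_eq \<Omega> v w \<longrightarrow> f v = f w) \<and>
     (\<forall>v\<in>H1_0_vec \<Omega>. \<forall>w\<in>H1_0_vec \<Omega>. f (\<lambda>x. v x + w x) = f v + f w) \<and>
     (\<forall>c. \<forall>v\<in>H1_0_vec \<Omega>. f (\<lambda>x. c *\<^sub>R v x) = c * f v) \<and>
     (\<exists>M. \<forall>v\<in>H1_0_vec \<Omega>. \<bar>f v\<bar> \<le> M * l2_norm \<Omega> (wjac \<Omega> v))}"

definition Hm1_norm :: "(real^3) set \<Rightarrow> ((real^3 \<Rightarrow> real^3) \<Rightarrow> real) \<Rightarrow> real" where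
  "Hm1_norm \<Omega> f =
     Sup {f v / l2_norm \<Omega> (wjac \<Omega> v) | v. v \<in> H1_0_vec \<Omega> \<and> \<not> ae_eq \<Omega> v (\<lambda>x. 0)}"


section \<open>The discrete de Rham complex\<close>

definition Pk :: "nat \<Rightarrow> (real^3 \<Rightarrow> real) set" where
  "Pk k = {p. \<exists>c. \<forall>x. p x =
     (\<Sum>(a, b, d)\<in>{(a, b, d). a + b + d \<le> k}. c a b d * x $ 1 ^ a * x $ 2 ^ b * x $ 3 ^ d)}"

definition Pk_vec :: "nat \<Rightarrow> (real^3 \<Rightarrow> real^3) set" where
  "Pk_vec k = {p. \<forall>i. (\<lambda>x. p x $ i) \<in> Pk k}"

text \<open>
  In the classical local spaces \<open>P\<^sub>k\<^sup>3 + x \<times> P\<^sub>k\<^sup>3\<close> (first kind Nedelec) and \<open>P\<^sub>k\<^sup>3 + x P\<^sub>k\<close>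
  (Raviart-Thomas) the second summand is often restricted to homogeneous polynomials of
  degree \<open>k\<close>, which gives the same spaces.
\<close>

definition nedelec1_local :: "nat \<Rightarrow> (real^3 \<Rightarrow> real^3) set" where
  "nedelec1_local k = {\<lambda>x. p x + cross3 x (q x) | p q. p \<in> Pk_vec k \<and> q \<in> Pk_vec k}"

definition rt_local :: "nat \<Rightarrow> (real^3 \<Rightarrow> real^3) set" where
  "rt_local k = {\<lambda>x. p x + q x *\<^sub>R x | p q. p \<in> Pk_vec k \<and> q \<in> Pk k}"

definition piecewise ::
    "(real^3) set set \<Rightarrow> (real^3 \<Rightarrow> 'b::euclidean_space) set \<Rightarrow> (real^3 \<Rightarrow> 'b) set" where
  "piecewise \<T> P = {v. \<forall>K\<in>\<T>. \<exists>p\<in>P. ae_eq K v p}"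

definition lagrange_0 where
  "lagrange_0 \<Omega> \<T> k = H1_0 \<Omega> \<inter> piecewise \<T> (Pk k)"

definition nedelec1_0 where
  "nedelec1_0 \<Omega> \<T> k = Hcurl_0 \<Omega> \<inter> piecewise \<T> (nedelec1_local k)"

definition nedelec2_0 where
  "nedelec2_0 \<Omega> \<T> k = Hcurl_0 \<Omega> \<inter> piecewise \<T> (Pk_vec k)"

definition rt_0 where
  "rt_0 \<Omega> \<T> k = Hdiv_0 \<Omega> \<inter> piecewise \<T> (rt_local k)"

definition bdm_0 where
  "bdm_0 \<Omega> \<T> k = Hdiv_0 \<Omega> \<inter> piecewise \<T> (Pk_vec k)"

definition dg_0 where
  "dg_0 \<Omega> \<T> k = L2_zero_mean \<Omega> \<inter> piecewise \<T> (Pk k)"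

text \<open>
  The four standard sequences, indexed by the degree of the discontinuous space at the end.
  Here \<open>k = 0\<close> is the lowest order for \<^const>\<open>nedelec1_0\<close> and \<^const>\<open>rt_0\<close>, whereas
  \<^const>\<open>nedelec2_0\<close> and \<^const>\<open>bdm_0\<close> start at degree 1.
\<close>

definition standard_fe_sequence where
  "standard_fe_sequence \<Omega> \<T> Gh Ch Dh Lh \<longleftrightarrow> (\<exists>k.
     (Gh, Ch, Dh, Lh) \<in>
       {(lagrange_0 \<Omega> \<T> (k+1), nedelec1_0 \<Omega> \<T> k,     rt_0 \<Omega> \<T> k,      dg_0 \<Omega> \<T> k),
        (lagrange_0 \<Omega> \<T> (k+2), nedelec2_0 \<Omega> \<T> (k+1), rt_0 \<Omega> \<T> k,      dg_0 \<Omega> \<T> k),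
        (lagrange_0 \<Omega> \<T> (k+2), nedelec1_0 \<Omega> \<T> (k+1), bdm_0 \<Omega> \<T> (k+1), dg_0 \<Omega> \<T> k),
        (lagrange_0 \<Omega> \<T> (k+3), nedelec2_0 \<Omega> \<T> (k+2), bdm_0 \<Omega> \<T> (k+1), dg_0 \<Omega> \<T> k)})"

text \<open>
  Exactness of \<open>0 \<rightarrow> Gh \<rightarrow> Ch \<rightarrow> Dh \<rightarrow> Lh \<rightarrow> 0\<close>, including that each operator maps into the next
  space.
\<close>

definition exact_de_rham ::
    "(real^3) set \<Rightarrow> (real^3 \<Rightarrow> real) set \<Rightarrow> (real^3 \<Rightarrow> real^3) set \<Rightarrow>
     (real^3 \<Rightarrow> real^3) set \<Rightarrow> (real^3 \<Rightarrow> real) set \<Rightarrow> bool" where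
  "exact_de_rham \<Omega> Gh Ch Dh Lh \<longleftrightarrow>
     (\<forall>\<phi>\<in>Gh. ae_eq \<Omega> (wgrad \<Omega> \<phi>) (\<lambda>x. 0) \<longrightarrow> ae_eq \<Omega> \<phi> (\<lambda>x. 0)) \<and>
     (\<forall>F. F \<in> Ch \<and> ae_eq \<Omega> (wcurl \<Omega> F) (\<lambda>x. 0) \<longleftrightarrow> (\<exists>\<phi>\<in>Gh. ae_eq \<Omega> F (wgrad \<Omega> \<phi>))) \<and>
     (\<forall>C. C \<in> Dh \<and> ae_eq \<Omega> (wdiv \<Omega> C) (\<lambda>x. 0) \<longleftrightarrow> (\<exists>F\<in>Ch. ae_eq \<Omega> C (wcurl \<Omega> F))) \<and>
     (\<forall>q. q \<in> Lh \<longleftrightarrow> (\<exists>C\<in>Dh. ae_eq \<Omega> q (wdiv \<Omega> C)))"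


section \<open>The Stokes pair\<close>

definition finite_dim_space ::
    "(real^3) set \<Rightarrow> (real^3 \<Rightarrow> 'b::euclidean_space) set \<Rightarrow> bool" where
  "finite_dim_space \<Omega> V \<longleftrightarrow>
     (\<lambda>x. 0) \<in> V \<and>
     (\<forall>v\<in>V. \<forall>w\<in>V. (\<lambda>x. v x + w x) \<in> V) \<and>
     (\<forall>c. \<forall>v\<in>V. (\<lambda>x. c *\<^sub>R v x) \<in> V) \<and>
     (\<exists>n::nat. \<exists>b. \<forall>v\<in>V. \<exists>c. ae_eq \<Omega> v (\<lambda>x. \<Sum>i<n. c i *\<^sub>R b i x))"

text \<open>The supremum is taken in \<^typ>\<open>ereal\<close>, so that it needs no boundedness side condition.\<close>

definition inf_sup_stable ::
    "real \<Rightarrow> (real^3) set \<Rightarrow> (real^3 \<Rightarrow> real^3) set \<Rightarrow> (real^3 \<Rightarrow> real) set \<Rightarrow> bool" where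
  "inf_sup_stable \<beta> \<Omega> Vh Qh \<longleftrightarrow>
     (\<forall>q\<in>Qh. \<not> ae_eq \<Omega> q (\<lambda>x. 0) \<longrightarrow>
        ereal \<beta> \<le> (SUP v\<in>{v\<in>Vh. \<not> ae_eq \<Omega> v (\<lambda>x. 0)}.
          ereal (l2_inner \<Omega> (wdiv \<Omega> v) q / (l2_norm \<Omega> (wjac \<Omega> v) * l2_norm \<Omega> q))))"

definition stokes_pair ::
    "real \<Rightarrow> (real^3) set \<Rightarrow> (real^3 \<Rightarrow> real^3) set \<Rightarrow> (real^3 \<Rightarrow> real) set \<Rightarrow> bool" where
  "stokes_pair \<beta> \<Omega> Vh Qh \<longleftrightarrow>
     finite_dim_space \<Omega> Vh \<and> Vh \<subseteq> H1_0_vec \<Omega> \<and>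
     finite_dim_space \<Omega> Qh \<and> Qh \<subseteq> L2_zero_mean \<Omega> \<and>
     0 < \<beta> \<and> inf_sup_stable \<beta> \<Omega> Vh Qh"


section \<open>The convection form\<close>

definition convection ::
    "(real^3) set \<Rightarrow> (real^3 \<Rightarrow> real^3) \<Rightarrow> (real^3 \<Rightarrow> real^3) \<Rightarrow> (real^3 \<Rightarrow> real^3) \<Rightarrow> real" where
  "convection \<Omega> w u v =
     1/2 * (l2_inner \<Omega> (\<lambda>x. wjac \<Omega> u x *v w x) v - l2_inner \<Omega> (\<lambda>x. wjac \<Omega> v x *v w x) u)"

end

theory Submission
  imports Defs
begin

text \<open>
  The complex makes \<open>curl E\<close> an admissible test field for Faraday's law, and the \<open>div\<close> term
  vanishes on it; hence \<open>curl E = 0\<close>. Testing the same law with \<open>B\<close> then leaves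
  \<open>\<parallel>div B\<parallel>\<^sup>2 = 0\<close>.

  For the energy law, the momentum equation is tested with \<open>u\<close>: the convection form is
  antisymmetric, the pressure term vanishes by incompressibility, and the Lorentz term is
  \<open>- S (j \<times> B, u) = S (j, u \<times> B)\<close>. Ohm's law tested with \<open>E\<close> gives \<open>S (j, E) = 0\<close>, because
  \<open>curl E = 0\<close>, so the Lorentz term equals \<open>S \<parallel>j\<parallel>\<^sup>2\<close>. The bound follows from the energy law by
  duality and Young's inequality.

  The one analytic point is that \<open>(j, E + u \<times> B)\<close> may be split into two integrals. This needs
  \<open>u \<times> B\<close> to be square integrable (\<open>L2_cross3\<close>), which can fail for general \<open>B\<close> in \<open>H(div)\<close> but
  holds here because a piecewise polynomial field on a finite mesh is essentially bounded
  (\<open>piecewise_continuous_AE_bounded\<close>).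
\<close>

section \<open>Square integrable functions\<close>

lemma L2_integrable_inner:
  fixes f g :: "real^3 \<Rightarrow> 'b::euclidean_space"
  assumes "f \<in> L2 \<Omega>" "g \<in> L2 \<Omega>"
  shows "integrable (lebesgue_on \<Omega>) (\<lambda>x. f x \<bullet> g x)"
proof (rule Bochner_Integration.integrable_bound)
  show "integrable (lebesgue_on \<Omega>) (\<lambda>x. (norm (f x))\<^sup>2 + (norm (g x))\<^sup>2)"
    using assms by (simp add: L2_def)
  show "(\<lambda>x. f x \<bullet> g x) \<in> borel_measurable (lebesgue_on \<Omega>)"
    using assms by (intro borel_measurable_inner) (simp_all add: L2_def)
  have "\<bar>a \<bullet> b\<bar> \<le> (norm a)\<^sup>2 + (norm b)\<^sup>2" for a b :: 'b
  proof -
    have "\<bar>a \<bullet> b\<bar> \<le> norm a * norm b" by (rule Cauchy_Schwarz_ineq2)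
    also have "\<dots> \<le> 2 * norm a * norm b" by simp
    also have "\<dots> \<le> (norm a)\<^sup>2 + (norm b)\<^sup>2" by (rule sum_squares_bound)
    finally show ?thesis .
  qed
  then show "AE x in lebesgue_on \<Omega>.
      norm (f x \<bullet> g x) \<le> norm ((norm (f x))\<^sup>2 + (norm (g x))\<^sup>2)"
    by simp
qed

lemma L2_add:
  fixes f g :: "real^3 \<Rightarrow> 'b::euclidean_space"
  assumes "f \<in> L2 \<Omega>" "g \<in> L2 \<Omega>"
  shows "(\<lambda>x. f x + g x) \<in> L2 \<Omega>"
proof -
  have "(\<lambda>x. (norm (f x + g x))\<^sup>2) = (\<lambda>x. f x \<bullet> f x + 2 * (f x \<bullet> g x) + g x \<bullet> g x)"
    by (simp add: power2_norm_eq_inner inner_add_left inner_add_right inner_commute algebra_simps)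
  moreover have "integrable (lebesgue_on \<Omega>) \<dots>"
    using assms by (intro Bochner_Integration.integrable_add integrable_mult_right
        L2_integrable_inner)
  moreover have "(\<lambda>x. f x + g x) \<in> borel_measurable (lebesgue_on \<Omega>)"
    using assms by (intro borel_measurable_add) (simp_all add: L2_def)
  ultimately show ?thesis
    by (simp add: L2_def)
qed

lemma L2_vec:
  fixes u :: "real^3 \<Rightarrow> real^'n"
  assumes "\<And>i. (\<lambda>x. u x $ i) \<in> L2 \<Omega>"
  shows "u \<in> L2 \<Omega>"
proof -
  have "u \<in> borel_measurable (lebesgue_on \<Omega>)"
    using assms
    by (subst borel_measurable_euclidean_space) (auto simp: Basis_vec_def inner_axis L2_def)
  moreover have "(\<lambda>x. (norm (u x))\<^sup>2) = (\<lambda>x. \<Sum>i\<in>UNIV. (u x $ i)\<^sup>2)"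
    by (simp only: power2_norm_eq_inner inner_vec_def) (simp add: power2_eq_square)
  moreover have "integrable (lebesgue_on \<Omega>) \<dots>"
    using assms by (intro Bochner_Integration.integrable_sum) (simp add: L2_def)
  ultimately show ?thesis
    by (simp add: L2_def)
qed

lemma l2_norm_power2: "(l2_norm \<Omega> f)\<^sup>2 = l2_inner \<Omega> f f"
  by (simp add: l2_norm_def l2_inner_def)

lemma l2_inner_commute: "l2_inner \<Omega> f g = l2_inner \<Omega> g f"
  by (simp add: l2_inner_def inner_commute)

lemma l2_inner_add_right:
  assumes "f \<in> L2 \<Omega>" "g \<in> L2 \<Omega>" "h \<in> L2 \<Omega>"
  shows "l2_inner \<Omega> f (\<lambda>x. g x + h x) = l2_inner \<Omega> f g + l2_inner \<Omega> f h"
  using assms by (simp add: l2_inner_def inner_add_right L2_integrable_inner)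

lemma l2_inner_eq_0_if_AE:
  assumes "ae_eq \<Omega> g (\<lambda>x. 0)"
  shows "l2_inner \<Omega> f g = 0"
  unfolding l2_inner_def
  by (rule integral_eq_zero_AE) (use assms in \<open>auto simp: ae_eq_def\<close>)

lemma ae_eq_0_if_l2_inner_self:
  assumes "f \<in> L2 \<Omega>" "l2_inner \<Omega> f f = 0"
  shows "ae_eq \<Omega> f (\<lambda>x. 0)"
  using integral_nonneg_eq_0_iff_AE[OF L2_integrable_inner[OF assms(1) assms(1)]] assms(2)
  by (simp add: l2_inner_def ae_eq_def)

text \<open>
  By \<open>|u \<times> B| \<le> |u| |B|\<close>, the product inherits square integrability from \<open>u\<close> once \<open>B\<close> is
  essentially bounded.
\<close>

lemma L2_cross3:
  fixes u B :: "real^3 \<Rightarrow> real^3"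
  assumes u: "u \<in> L2 \<Omega>" and B: "B \<in> borel_measurable (lebesgue_on \<Omega>)"
    and bound: "AE x in lebesgue_on \<Omega>. norm (B x) \<le> M"
  shows "(\<lambda>x. cross3 (u x) (B x)) \<in> L2 \<Omega>"
proof -
  have meas: "(\<lambda>x. cross3 (u x) (B x)) \<in> borel_measurable (lebesgue_on \<Omega>)"
  proof (rule borel_measurable_continuous_Pair[where H = cross3])
    show "continuous_on UNIV (\<lambda>z. cross3 (fst z) (snd z) :: real^3)"
      by (intro continuous_on_cross continuous_intros)
  qed (use u B in \<open>simp_all add: L2_def\<close>)
  have "integrable (lebesgue_on \<Omega>) (\<lambda>x. (norm (cross3 (u x) (B x)))\<^sup>2)"
  proof (rule Bochner_Integration.integrable_bound)
    show "integrable (lebesgue_on \<Omega>) (\<lambda>x. M\<^sup>2 * (norm (u x))\<^sup>2)"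
      using u by (simp add: L2_def)
    show "(\<lambda>x. (norm (cross3 (u x) (B x)))\<^sup>2) \<in> borel_measurable (lebesgue_on \<Omega>)"
      using meas by measurable
    show "AE x in lebesgue_on \<Omega>.
        norm ((norm (cross3 (u x) (B x)))\<^sup>2) \<le> norm (M\<^sup>2 * (norm (u x))\<^sup>2)"
      using bound
    proof eventually_elim
      case (elim x)
      have "(norm (cross3 (u x) (B x)))\<^sup>2 \<le> (norm (u x) * norm (B x))\<^sup>2"
        using norm_cross_dot[of "u x" "B x"]
        by (metis le_add_same_cancel1 zero_le_power2)
      also have "\<dots> \<le> (norm (u x) * M)\<^sup>2"
        using elim by (intro power_mono mult_left_mono) auto
      finally show ?case by (simp add: power_mult_distrib mult.commute)
    qed
  qed
  with meas show ?thesis by (simp add: L2_def)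
qed

section \<open>Essential boundedness of piecewise polynomials\<close>

lemma Pk_continuous: "p \<in> Pk k \<Longrightarrow> continuous_on UNIV p"
proof -
  assume "p \<in> Pk k"
  then obtain c where "p = (\<lambda>x. \<Sum>(a, b, d)\<in>{(a, b, d). a + b + d \<le> k}.
      c a b d * x $ 1 ^ a * x $ 2 ^ b * x $ 3 ^ d)"
    by (auto simp: Pk_def)
  then show ?thesis
    by (simp only: case_prod_unfold) (intro continuous_intros)
qed

lemma Pk_vec_continuous: "p \<in> Pk_vec k \<Longrightarrow> continuous_on UNIV p"
  using Pk_continuous
  by (subst continuous_on_componentwise) (force simp: Pk_vec_def Basis_vec_def inner_axis)

lemma rt_local_continuous: "p \<in> rt_local k \<Longrightarrow> continuous_on UNIV p"
  unfolding rt_local_def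
  by (auto dest: Pk_continuous Pk_vec_continuous intro!: continuous_intros)

text \<open>
  On each of the finitely many compact cells the function has a continuous representative,
  which is bounded there. The sum of the cell bounds serves as a common bound that is defined
  even for an empty mesh.
\<close>

lemma piecewise_continuous_AE_bounded:
  fixes v :: "real^3 \<Rightarrow> 'b::euclidean_space"
  assumes \<T>: "finite \<T>" "\<And>K. K \<in> \<T> \<Longrightarrow> compact K" and \<Omega>: "\<Omega> \<in> sets lebesgue" "\<Omega> \<subseteq> \<Union>\<T>"
    and P: "\<And>p. p \<in> P \<Longrightarrow> continuous_on UNIV p" and v: "v \<in> piecewise \<T> P"
  shows "\<exists>M. AE x in lebesgue_on \<Omega>. norm (v x) \<le> M"
proof -
  have "\<exists>m. AE x in lebesgue. x \<in> K \<longrightarrow> norm (v x) \<le> m" if K: "K \<in> \<T>" for K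
  proof -
    obtain p where p: "p \<in> P" "ae_eq K v p"
      using v K by (auto simp: piecewise_def)
    have "continuous_on K p"
      using P[OF p(1)] continuous_on_subset by blast
    then have "bounded (p ` K)"
      using \<T>(2)[OF K] compact_continuous_image compact_imp_bounded by blast
    then obtain m where m: "\<And>x. x \<in> K \<Longrightarrow> norm (p x) \<le> m"
      by (auto simp: bounded_iff)
    have "K \<in> sets lebesgue"
      using \<T>(2)[OF K] by (simp add: lmeasurable_compact fmeasurableD)
    then have "AE x in lebesgue. x \<in> K \<longrightarrow> v x = p x"
      using p(2) by (simp add: ae_eq_def AE_restrict_space_iff)
    then have "AE x in lebesgue. x \<in> K \<longrightarrow> norm (v x) \<le> m"
      by eventually_elim (use m in auto)
    then show ?thesis ..
  qed
  then obtain m where "\<And>K. K \<in> \<T> \<Longrightarrow> AE x in lebesgue. x \<in> K \<longrightarrow> norm (v x) \<le> m K"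
    by metis
  then have "AE x in lebesgue. \<forall>K\<in>\<T>. x \<in> K \<longrightarrow> norm (v x) \<le> m K"
    using \<T>(1) by (intro AE_finite_allI) auto
  then have "AE x in lebesgue. x \<in> \<Omega> \<longrightarrow> norm (v x) \<le> (\<Sum>K\<in>\<T>. \<bar>m K\<bar>)"
  proof eventually_elim
    case (elim x)
    show ?case
    proof
      assume "x \<in> \<Omega>"
      then obtain K where K: "K \<in> \<T>" "x \<in> K"
        using \<Omega>(2) by auto
      then have "norm (v x) \<le> \<bar>m K\<bar>"
        using elim by force
      also have "\<dots> \<le> (\<Sum>K\<in>\<T>. \<bar>m K\<bar>)"
        using K(1) \<T>(1) by (intro member_le_sum) auto
      finally show "norm (v x) \<le> (\<Sum>K\<in>\<T>. \<bar>m K\<bar>)" .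
    qed
  qed
  then show ?thesis
    using \<Omega>(1) by (auto simp: AE_restrict_space_iff)
qed

section \<open>Weak derivatives and the dual norm\<close>

lemma wcurl_L2: "F \<in> Hcurl \<Omega> \<Longrightarrow> wcurl \<Omega> F \<in> L2 \<Omega>"
  unfolding wcurl_def by (rule someI2_ex[where Q = "\<lambda>g. g \<in> L2 \<Omega>"]) (auto simp: Hcurl_def)

lemma wdiv_L2: "C \<in> Hdiv \<Omega> \<Longrightarrow> wdiv \<Omega> C \<in> L2 \<Omega>"
  unfolding wdiv_def by (rule someI2_ex[where Q = "\<lambda>g. g \<in> L2 \<Omega>"]) (auto simp: Hdiv_def)

lemma H1_0_vec_subset_L2: "H1_0_vec \<Omega> \<subseteq> L2 \<Omega>"
  by (auto simp: H1_0_vec_def H1_0_def H1_def intro!: L2_vec)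

text \<open>
  Division by zero and the exclusion of \<open>v = 0\<close> from the supremum make two degenerate cases:
  if \<open>\<nabla>v\<close> vanishes then so does \<open>f v\<close> by continuity of \<open>f\<close>, and if \<open>v\<close> vanishes almost
  everywhere then \<open>f v = 0\<close> because \<open>f\<close> is linear on classes. Continuity also bounds the set of
  quotients, without which its supremum would be meaningless. The absolute value on the right
  covers the second case, where the set of quotients could be empty and its supremum an
  unspecified number.
\<close>

lemma Hm1_norm_bound:
  assumes f: "f \<in> Hm1_vec \<Omega>" and v: "v \<in> H1_0_vec \<Omega>" and zero: "(\<lambda>x. 0) \<in> H1_0_vec \<Omega>"
  shows "f v \<le> \<bar>Hm1_norm \<Omega> f\<bar> * l2_norm \<Omega> (wjac \<Omega> v)"
proof -
  let ?n = "\<lambda>v. l2_norm \<Omega> (wjac \<Omega> v)"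
  let ?A = "{f v / ?n v | v. v \<in> H1_0_vec \<Omega> \<and> \<not> ae_eq \<Omega> v (\<lambda>x. 0)}"
  have n: "0 \<le> ?n v" for v
    by (simp add: l2_norm_def l2_inner_def)
  obtain M where M: "\<And>v. v \<in> H1_0_vec \<Omega> \<Longrightarrow> \<bar>f v\<bar> \<le> M * ?n v"
    using f unfolding Hm1_vec_def by blast
  consider "ae_eq \<Omega> v (\<lambda>x. 0)" | "?n v = 0" | "\<not> ae_eq \<Omega> v (\<lambda>x. 0)" "0 < ?n v"
    using n[of v] by linarith
  then show ?thesis
  proof cases
    case 1
    then have "f v = f (\<lambda>x. 0)"
      using f v zero by (auto simp: Hm1_vec_def)
    moreover have "f (\<lambda>x. c *\<^sub>R 0) = c * f (\<lambda>x. 0)" for c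
      using f zero by (simp add: Hm1_vec_def del: scaleR_zero_right)
    from this[of 0] have "f (\<lambda>x. 0) = 0"
      by simp
    ultimately show ?thesis
      using n[of v] by simp
  next
    case 2
    then show ?thesis
      using M[OF v] by simp
  next
    case 3
    have "bdd_above ?A"
    proof (rule bdd_aboveI)
      fix y assume "y \<in> ?A"
      then obtain w where w: "w \<in> H1_0_vec \<Omega>" "y = f w / ?n w"
        by auto
      show "y \<le> \<bar>M\<bar>"
      proof (cases "?n w = 0")
        case True
        then show ?thesis by (simp add: w(2))
      next
        case False
        have "f w \<le> M * ?n w"
          using M[OF w(1)] by linarith
        also have "\<dots> \<le> \<bar>M\<bar> * ?n w"
          using n[of w] by (intro mult_right_mono) auto
        finally show ?thesis
          using False n[of w] by (simp add: w(2) divide_le_eq)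
      qed
    qed
    moreover have "f v / ?n v \<in> ?A"
      using v 3 by blast
    ultimately have "f v / ?n v \<le> Hm1_norm \<Omega> f"
      unfolding Hm1_norm_def by (rule cSup_upper[rotated])
    also have "\<dots> \<le> \<bar>Hm1_norm \<Omega> f\<bar>"
      by simp
    finally show ?thesis
      using 3(2) by (simp add: divide_le_eq)
  qed
qed

section \<open>Conforming finite element spaces\<close>

lemma standard_fe_sequence_Hcurl:
  assumes "standard_fe_sequence \<Omega> \<T> Gh Ch Dh Lh"
  shows "Ch \<subseteq> Hcurl \<Omega>"
  using assms
  by (auto simp: standard_fe_sequence_def nedelec1_0_def nedelec2_0_def Hcurl_0_def)

lemma standard_fe_sequence_Hdiv:
  assumes "standard_fe_sequence \<Omega> \<T> Gh Ch Dh Lh"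
  shows "Dh \<subseteq> Hdiv \<Omega>"
  using assms by (auto simp: standard_fe_sequence_def rt_0_def bdm_0_def Hdiv_0_def)

lemma standard_fe_sequence_piecewise_continuous:
  assumes "standard_fe_sequence \<Omega> \<T> Gh Ch Dh Lh"
  shows "Dh \<subseteq> piecewise \<T> {p. continuous_on UNIV p}"
proof -
  obtain k where "Dh = rt_0 \<Omega> \<T> k \<or> Dh = bdm_0 \<Omega> \<T> (k + 1)"
    using assms by (auto simp: standard_fe_sequence_def)
  then show ?thesis
    using rt_local_continuous Pk_vec_continuous
    unfolding rt_0_def bdm_0_def piecewise_def by blast
qed

text \<open>
  The exactness condition at the third space is stated up to null sets; it is applied here to
  the representative \<open>wcurl \<Omega> F\<close> itself, which makes it a legitimate test field.
\<close>

lemma exact_de_rham_wcurl: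
  assumes "exact_de_rham \<Omega> Gh Ch Dh Lh" "F \<in> Ch"
  shows "wcurl \<Omega> F \<in> Dh" "ae_eq \<Omega> (wdiv \<Omega> (wcurl \<Omega> F)) (\<lambda>x. 0)"
proof -
  have "ae_eq \<Omega> (wcurl \<Omega> F) (wcurl \<Omega> F)"
    by (simp add: ae_eq_def)
  then show "wcurl \<Omega> F \<in> Dh" "ae_eq \<Omega> (wdiv \<Omega> (wcurl \<Omega> F)) (\<lambda>x. 0)"
    using assms unfolding exact_de_rham_def by blast+
qed

section \<open>The Gauss law and the energy law\<close>

theorem theorem8:
  fixes \<Omega> :: "(real^3) set" and \<T> :: "(real^3) set set"
    and R\<^sub>e R\<^sub>m S \<alpha> \<sigma> \<tau> \<beta> :: real
    and f :: "(real^3 \<Rightarrow> real^3) \<Rightarrow> real"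
    and Gh Lh Qh :: "(real^3 \<Rightarrow> real) set"
    and Ch Dh Vh :: "(real^3 \<Rightarrow> real^3) set"
    and Xh :: "((real^3 \<Rightarrow> real^3) \<times> (real^3 \<Rightarrow> real^3) \<times> (real^3 \<Rightarrow> real^3)) set"
    and u E B j :: "real^3 \<Rightarrow> real^3" and p :: "real^3 \<Rightarrow> real"
  assumes domain: "contractible_lipschitz_polyhedron \<Omega>"
    and mesh: "simplicial_mesh \<Omega> \<T>" "shape_regular \<sigma> \<T>" "quasi_uniform \<tau> \<T>"
    and constants: "0 < R\<^sub>e" "0 < R\<^sub>m" "0 < S" "\<alpha> = S / R\<^sub>m"
    and f: "f \<in> Hm1_vec \<Omega>"
    and complex: "standard_fe_sequence \<Omega> \<T> Gh Ch Dh Lh" "exact_de_rham \<Omega> Gh Ch Dh Lh"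
    and stokes: "stokes_pair \<beta> \<Omega> Vh Qh"
    and Xh: "Xh = Vh \<times> Ch \<times> Dh"
    and solution: "(u, E, B) \<in> Xh" "p \<in> Qh"
    and j: "j = (\<lambda>x. E x + cross3 (u x) (B x))"
    and momentum: "\<And>v F C. (v, F, C) \<in> Xh \<Longrightarrow>
          convection \<Omega> u u v + inverse R\<^sub>e * l2_inner \<Omega> (wjac \<Omega> u) (wjac \<Omega> v)
          - S * l2_inner \<Omega> (\<lambda>x. cross3 (j x) (B x)) v - l2_inner \<Omega> p (wdiv \<Omega> v) = f v"
    and ohm: "\<And>v F C. (v, F, C) \<in> Xh \<Longrightarrow>
          S * l2_inner \<Omega> j F - \<alpha> * l2_inner \<Omega> B (wcurl \<Omega> F) = 0"
    and faraday: "\<And>v F C. (v, F, C) \<in> Xh \<Longrightarrow>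
          \<alpha> * l2_inner \<Omega> (wcurl \<Omega> E) C + \<alpha> * l2_inner \<Omega> (wdiv \<Omega> B) (wdiv \<Omega> C) = 0"
    and incompressible: "\<And>q. q \<in> Qh \<Longrightarrow> - l2_inner \<Omega> (wdiv \<Omega> u) q = 0"
  shows "(AE x in lebesgue_on \<Omega>. wdiv \<Omega> B x = 0) \<and>
         inverse R\<^sub>e * (l2_norm \<Omega> (wjac \<Omega> u))\<^sup>2 + S * (l2_norm \<Omega> j)\<^sup>2 = f u \<and>
         1/2 * inverse R\<^sub>e * (l2_norm \<Omega> (wjac \<Omega> u))\<^sup>2 + S * (l2_norm \<Omega> j)\<^sup>2
           \<le> R\<^sub>e / 2 * (Hm1_norm \<Omega> f)\<^sup>2"
proof -
  have uV: "u \<in> Vh" and EC: "E \<in> Ch" and BD: "B \<in> Dh"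
    using solution(1) by (auto simp: Xh)
  have V: "Vh \<subseteq> H1_0_vec \<Omega>" and zero: "(\<lambda>x. 0) \<in> H1_0_vec \<Omega>"
    using stokes by (auto simp: stokes_pair_def finite_dim_space_def)
  have \<alpha>: "0 < \<alpha>"
    using constants by simp
  have E: "E \<in> Hcurl \<Omega>" and B: "B \<in> Hdiv \<Omega>"
    using EC BD complex(1) standard_fe_sequence_Hcurl standard_fe_sequence_Hdiv by blast+

  have curlE: "ae_eq \<Omega> (wcurl \<Omega> E) (\<lambda>x. 0)"
  proof -
    note C = exact_de_rham_wcurl[OF complex(2) EC]
    have "\<alpha> * l2_inner \<Omega> (wcurl \<Omega> E) (wcurl \<Omega> E)
        + \<alpha> * l2_inner \<Omega> (wdiv \<Omega> B) (wdiv \<Omega> (wcurl \<Omega> E)) = 0"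
      using faraday[of u E "wcurl \<Omega> E"] uV EC C(1) by (simp add: Xh)
    then have "l2_inner \<Omega> (wcurl \<Omega> E) (wcurl \<Omega> E) = 0"
      using \<alpha> by (simp add: l2_inner_eq_0_if_AE[OF C(2)])
    then show ?thesis
      by (rule ae_eq_0_if_l2_inner_self[OF wcurl_L2[OF E]])
  qed

  have gauss: "ae_eq \<Omega> (wdiv \<Omega> B) (\<lambda>x. 0)"
  proof -
    have "l2_inner \<Omega> (wcurl \<Omega> E) B = 0"
      using l2_inner_eq_0_if_AE[OF curlE] by (simp add: l2_inner_commute[of \<Omega> _ B])
    then have "l2_inner \<Omega> (wdiv \<Omega> B) (wdiv \<Omega> B) = 0"
      using faraday[OF solution(1)] \<alpha> by simp
    then show ?thesis
      by (rule ae_eq_0_if_l2_inner_self[OF wdiv_L2[OF B]])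
  qed

  have uB: "(\<lambda>x. cross3 (u x) (B x)) \<in> L2 \<Omega>"
  proof -
    have "open \<Omega>"
      using domain by (simp add: contractible_lipschitz_polyhedron_def)
    then have "\<Omega> \<in> sets lebesgue"
      by (simp add: borel_open)
    moreover have "finite \<T>" "\<And>K. K \<in> \<T> \<Longrightarrow> compact K" "\<Omega> \<subseteq> \<Union>\<T>"
      using mesh(1) closure_subset[of \<Omega>]
      by (auto simp: simplicial_mesh_def triangulation_def intro: compact_simplex)
    moreover have "B \<in> piecewise \<T> {p. continuous_on UNIV p}"
      using BD standard_fe_sequence_piecewise_continuous[OF complex(1)] by blast
    ultimately obtain M where "AE x in lebesgue_on \<Omega>. norm (B x) \<le> M"
      using piecewise_continuous_AE_bounded[of \<T> \<Omega> "{p. continuous_on UNIV p}" B] by auto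
    then show ?thesis
      using uV V H1_0_vec_subset_L2 B by (intro L2_cross3) (auto simp: Hdiv_def L2_def)
  qed

  have jj: "l2_inner \<Omega> j j = - l2_inner \<Omega> (\<lambda>x. cross3 (j x) (B x)) u"
  proof -
    have EL: "E \<in> L2 \<Omega>"
      using E by (simp add: Hcurl_def)
    have jL: "j \<in> L2 \<Omega>"
      unfolding j by (rule L2_add[OF EL uB])
    have "l2_inner \<Omega> j E = 0"
      using ohm[OF solution(1)] constants(3) by (simp add: l2_inner_eq_0_if_AE[OF curlE])
    moreover have "l2_inner \<Omega> j j = l2_inner \<Omega> j E + l2_inner \<Omega> j (\<lambda>x. cross3 (u x) (B x))"
      using l2_inner_add_right[OF jL EL uB] by (simp flip: j)
    moreover have "a \<bullet> cross3 b c = - (cross3 a c \<bullet> b)" for a b c :: "real^3"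
      by (simp add: cross3_simps)
    ultimately show ?thesis
      by (simp add: l2_inner_def)
  qed

  have energy: "inverse R\<^sub>e * (l2_norm \<Omega> (wjac \<Omega> u))\<^sup>2 + S * (l2_norm \<Omega> j)\<^sup>2 = f u"
    using momentum[OF solution(1)] incompressible[OF solution(2)]
    by (simp add: l2_norm_power2 jj convection_def l2_inner_commute[of \<Omega> p])

  have "1/2 * inverse R\<^sub>e * (l2_norm \<Omega> (wjac \<Omega> u))\<^sup>2 + S * (l2_norm \<Omega> j)\<^sup>2
      \<le> R\<^sub>e / 2 * (Hm1_norm \<Omega> f)\<^sup>2"
  proof -
    define a b where "a = \<bar>Hm1_norm \<Omega> f\<bar>" and "b = l2_norm \<Omega> (wjac \<Omega> u)"
    have "f u \<le> a * b"
      unfolding a_def b_def using uV V by (intro Hm1_norm_bound[OF f _ zero]) auto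
    also have "\<dots> \<le> R\<^sub>e / 2 * a\<^sup>2 + 1/2 * inverse R\<^sub>e * b\<^sup>2"
    proof -
      \<comment> \<open>Young's inequality, scaled so that the gradient term takes half of the viscous one.\<close>
      have "0 \<le> (R\<^sub>e * a - b)\<^sup>2 / (2 * R\<^sub>e)"
        using constants(1) by simp
      also have "\<dots> = R\<^sub>e / 2 * a\<^sup>2 + 1/2 * inverse R\<^sub>e * b\<^sup>2 - a * b"
        using constants(1) by (simp add: field_simps power2_eq_square)
      finally show ?thesis by simp
    qed
    finally show ?thesis
      using energy by (simp add: a_def b_def)
  qed
  with gauss energy show ?thesis
    by (simp add: ae_eq_def)
qed

end
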